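(* Let $(X,\widehat d_X)$ be a non-Archimedean metric space in which every ball contains at least two distinct elements, and let $(A,|\cdot|)$ be a non-Archimedean valued ring. Then $\widehat{BL}(X\to A)$ is an $A$-subalgebra of $\mathfrak M(X\to A)$, and $\|\cdot\|_{\widehat{BL}}$ is a non-Archimedean norm on it as an $A$-module. Moreover, for any $f,g\in\widehat{BL}(X\to A)$, $$\|fg\|_{\widehat{BL}}\le\|f\|_{\widehat{BL}}\cdot\|g\|_{\widehat{BL}}.$$
   Context: A non-Archimedean metric satisfies $\widehat d(x,z)\le\max\{\widehat d(x,y),\widehat d(y,z)\}$ (metrics may take the value $+\infty$). A ball in $X$ is a set $\{x:\widehat d_X(a,x)<r\}$ or $\{x:\widehat d_X(a,x)\le r\}$ with $a\in X$, $0<r<\infty$. A non-Archimedean valued ring is a commutative ring $A$ with a function $|\cdot|:A\to\mathbb R$ satisfying $|a|\ge0$ with $|a|=0\iff a=0$, $|ab|=|a||b|$, and $|a+b|\le\max\{|a|,|b|\}$. $\mathfrak M(X\to A)$ is the commutative $A$-algebra of all maps $X\to A$ with pointwise operations $(f+g)(x)=f(x)+g(x)$, $(af)(x)=af(x)$, $(fg)(x)=f(x)g(x)$. For $f\in\mathfrak M(X\to A)$, $\|f\|_\infty=\sup_{x\in X}|f(x)|$; $\operatorname{dil}(f)=\sup_{x_1\ne x_2}\frac{|f(x_1)-f(x_2)|}{\widehat d_X(x_1,x_2)}$ (equal to $+\infty$ if $f$ is not Lipschitz; a quotient with infinite denominator is $0$); $\|f\|_{\widehat{BL}}=\max\{\|f\|_\infty,\operatorname{dil}(f)\}$;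 and $\widehat{BL}(X\to A)=\{f\in\mathfrak M(X\to A):\|f\|_{\widehat{BL}}<\infty\}$. A non-Archimedean norm on an $A$-module $M$ is a function $\|\cdot\|:M\to[0,\infty)$ with $\|f\|=0\iff f=0$, $\|f+g\|\le\max\{\|f\|,\|g\|\}$ and $\|af\|=|a|\,\|f\|$ for $a\in A$. *)

theory Defs
  imports "HOL-Algebra.Module" "HOL-Algebra.Subrings"
    "HOL-Library.Extended_Nonnegative_Real"
begin

text \<open>
  A non-Archimedean metric on the carrier set \<open>X\<close>; the distance may be infinite,
  so it takes values in the extended nonnegative reals.
\<close>

locale nonarch_metric_space =
  fixes X :: "'x set" and d :: "'x \<Rightarrow> 'x \<Rightarrow> ennreal"
  assumes zero_iff: "\<lbrakk>x \<in> X; y \<in> X\<rbrakk> \<Longrightarrow> d x y = 0 \<longleftrightarrow> x = y"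
    and commute: "\<lbrakk>x \<in> X; y \<in> X\<rbrakk> \<Longrightarrow> d x y = d y x"
    and strong_triangle:
      "\<lbrakk>x \<in> X; y \<in> X; z \<in> X\<rbrakk> \<Longrightarrow> d x z \<le> max (d x y) (d y z)"

definition is_ball :: "'x set \<Rightarrow> ('x \<Rightarrow> 'x \<Rightarrow> ennreal) \<Rightarrow> 'x set \<Rightarrow> bool" where
  "is_ball X d B \<longleftrightarrow> (\<exists>a\<in>X. \<exists>r::real. 0 < r \<and>
     (B = {x \<in> X. d a x < ennreal r} \<or> B = {x \<in> X. d a x \<le> ennreal r}))"

locale nonarch_valued_ring = cring A for A :: "('a, 'm) ring_scheme" (structure) +
  fixes v :: "'a \<Rightarrow> real"
  assumes val_nonneg: "a \<in> carrier A \<Longrightarrow> 0 \<le> v a"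
    and val_zero_iff: "a \<in> carrier A \<Longrightarrow> v a = 0 \<longleftrightarrow> a = \<zero>"
    and val_mult: "\<lbrakk>a \<in> carrier A; b \<in> carrier A\<rbrakk> \<Longrightarrow> v (a \<otimes> b) = v a * v b"
    and val_add: "\<lbrakk>a \<in> carrier A; b \<in> carrier A\<rbrakk> \<Longrightarrow> v (a \<oplus> b) \<le> max (v a) (v b)"

text \<open>
  The algebra of all maps from \<open>X\<close> to \<open>A\<close>. Maps are extensional (undefined outside \<open>X\<close>),
  so that equality of elements is equality of maps on \<open>X\<close>.
\<close>

definition map_algebra ::
    "'x set \<Rightarrow> ('a, 'm) ring_scheme \<Rightarrow> ('a, 'x \<Rightarrow> 'a) module" where
  "map_algebra X A =
    \<lparr>carrier = X \<rightarrow>\<^sub>E carrier A,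
     monoid.mult = (\<lambda>f g. \<lambda>x\<in>X. f x \<otimes>\<^bsub>A\<^esub> g x),
     one = (\<lambda>x\<in>X. \<one>\<^bsub>A\<^esub>),
     zero = (\<lambda>x\<in>X. \<zero>\<^bsub>A\<^esub>),
     add = (\<lambda>f g. \<lambda>x\<in>X. f x \<oplus>\<^bsub>A\<^esub> g x),
     smult = (\<lambda>a f. \<lambda>x\<in>X. a \<otimes>\<^bsub>A\<^esub> f x)\<rparr>"

text \<open>Subalgebras are unital: \<^const>\<open>subring\<close> requires the unit of the ambient ring.\<close>

definition is_subalgebra ::
    "'b set \<Rightarrow> ('a, 'm) ring_scheme \<Rightarrow> ('a, 'b, 'n) module_scheme \<Rightarrow> bool" where
  "is_subalgebra H R M \<longleftrightarrow> algebra R M \<and> submodule H R M \<and> subring H M"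

text \<open>
  Suprema are taken in \<^typ>\<open>ennreal\<close>, where the supremum of the empty set is 0 and
  a quotient with infinite denominator is 0.
\<close>

definition sup_norm :: "'x set \<Rightarrow> ('a \<Rightarrow> real) \<Rightarrow> ('x \<Rightarrow> 'a) \<Rightarrow> ennreal" where
  "sup_norm X v f = (SUP x\<in>X. ennreal (v (f x)))"

definition dil ::
    "'x set \<Rightarrow> ('x \<Rightarrow> 'x \<Rightarrow> ennreal) \<Rightarrow> ('a, 'm) ring_scheme \<Rightarrow> ('a \<Rightarrow> real)
      \<Rightarrow> ('x \<Rightarrow> 'a) \<Rightarrow> ennreal" where
  "dil X d A v f =
    (SUP (x, y)\<in>{(x, y). x \<in> X \<and> y \<in> X \<and> x \<noteq> y}. ennreal (v (f x \<ominus>\<^bsub>A\<^esub> f y)) / d x y)"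

definition BL_norm ::
    "'x set \<Rightarrow> ('x \<Rightarrow> 'x \<Rightarrow> ennreal) \<Rightarrow> ('a, 'm) ring_scheme \<Rightarrow> ('a \<Rightarrow> real)
      \<Rightarrow> ('x \<Rightarrow> 'a) \<Rightarrow> ennreal" where
  "BL_norm X d A v f = max (sup_norm X v f) (dil X d A v f)"

definition BL ::
    "'x set \<Rightarrow> ('x \<Rightarrow> 'x \<Rightarrow> ennreal) \<Rightarrow> ('a, 'm) ring_scheme \<Rightarrow> ('a \<Rightarrow> real)
      \<Rightarrow> ('x \<Rightarrow> 'a) set" where
  "BL X d A v = {f \<in> carrier (map_algebra X A). BL_norm X d A v f < \<infinity>}"

locale nonarch_module_norm =
  nonarch_valued_ring A v + module A M
  for A :: "('a, 'm) ring_scheme" and v :: "'a \<Rightarrow> real"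
    and M :: "('a, 'b, 'n) module_scheme" +
  fixes N :: "'b \<Rightarrow> real"
  assumes norm_nonneg: "f \<in> carrier M \<Longrightarrow> 0 \<le> N f"
    and norm_zero_iff: "f \<in> carrier M \<Longrightarrow> N f = 0 \<longleftrightarrow> f = \<zero>\<^bsub>M\<^esub>"
    and norm_add: "\<lbrakk>f \<in> carrier M; g \<in> carrier M\<rbrakk> \<Longrightarrow> N (f \<oplus>\<^bsub>M\<^esub> g) \<le> max (N f) (N g)"
    and norm_smult: "\<lbrakk>a \<in> carrier A; f \<in> carrier M\<rbrakk> \<Longrightarrow> N (a \<odot>\<^bsub>M\<^esub> f) = v a * N f"

lemma algebra_map_algebra:
  fixes A :: "('a, 'm) ring_scheme" and X :: "'x set"
  assumes "cring A"
  shows "algebra A (map_algebra X A)"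
proof -
  interpret cring A by fact
  have fin: "f x \<in> carrier A" if "f \<in> X \<rightarrow>\<^sub>E carrier A" "x \<in> X" for f :: "'x \<Rightarrow> 'a" and x
    using that by auto
  have ag: "abelian_group (map_algebra X A)"
  proof (rule abelian_groupI)
    fix f assume "f \<in> carrier (map_algebra X A)"
    then show "\<exists>g\<in>carrier (map_algebra X A). g \<oplus>\<^bsub>map_algebra X A\<^esub> f = \<zero>\<^bsub>map_algebra X A\<^esub>"
      by (intro bexI[where x = "\<lambda>x\<in>X. \<ominus>\<^bsub>A\<^esub> f x"])
        (auto simp: map_algebra_def l_neg fin intro!: restrict_ext)
  qed (auto simp: map_algebra_def fin a_ac PiE_iff extensional_def fun_eq_iff)
  have cm: "comm_monoid (map_algebra X A)"
    by (rule comm_monoidI)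
      (auto simp: map_algebra_def fin m_ac PiE_iff extensional_def fun_eq_iff)
  have cr: "cring (map_algebra X A)"
    by (rule cringI[OF ag cm])
      (auto simp: map_algebra_def fin l_distr intro!: restrict_ext)
  show ?thesis
    by (rule algebraI[OF assms cr])
      (auto simp: map_algebra_def fin l_distr r_distr m_assoc PiE_iff extensional_def fun_eq_iff)
qed

end

theory Submission
  imports Defs
begin

text \<open>
  The norm \<open>BL_norm\<close> is a supremum over two families: the values \<open>|f x|\<close> and the
  difference quotients \<open>|f x - f y| / d x y\<close>. An inequality for the norm is
  therefore a pointwise inequality for each family.

  For sums, \<open>(f + g) x - (f + g) y = (f x - f y) + (g x - g y)\<close>, and the ultrametric
  inequality in \<open>A\<close> bounds both families by the maximum of the two norms. For products,
  the Leibniz splitting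
  \<open>f x * g x - f y * g y = f x * (g x - g y) + g y * (f x - f y)\<close> gives, after division
  by \<open>d x y\<close>, the bound
  \<open>dil (f g) \<le> max (sup f * dil g) (sup g * dil f)\<close>. In the Archimedean setting the two terms
  would add up and cost a constant; here only their maximum matters, and each of them is at
  most \<open>BL_norm f * BL_norm g\<close>. Multiplication by a scalar \<open>a\<close> multiplies every
  member of both families by \<open>|a|\<close>, which commutes with suprema.
  Closure of \<open>BL\<close> under the algebra operations is the finiteness of these bounds.
  Definiteness is already a property of the supremum norm.
\<close>

section \<open>Comparing the norm with its defining families\<close>

lemma BL_norm_leI:
  assumes "\<And>x. x \<in> X \<Longrightarrow> ennreal (v (f x)) \<le> C"
    and "\<And>x y. \<lbrakk>x \<in> X; y \<in> X; x \<noteq> y\<rbrakk> \<Longrightarrow> ennreal (v (f x \<ominus>\<^bsub>A\<^esub> f y)) / d x y \<le> C"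
  shows "BL_norm X d A v f \<le> C"
  unfolding BL_norm_def sup_norm_def dil_def using assms
  by (auto intro!: SUP_least)

lemma value_le_BL_norm:
  assumes "x \<in> X"
  shows "ennreal (v (f x)) \<le> BL_norm X d A v f"
  unfolding BL_norm_def sup_norm_def using assms
  by (intro max.coboundedI1 SUP_upper)

text \<open>
  Infinite distances are the reason to work with quotients and not with
  \<open>|f x - f y| \<le> dil f * d x y\<close>: a map that is constant on each class of points at finite
  distance from one another has \<open>dil f = 0\<close>, and \<open>0 * \<infinity> = 0\<close> makes that
  inequality false for points in different classes with different values.
\<close>

lemma quotient_le_BL_norm:
  assumes "x \<in> X" "y \<in> X" "x \<noteq> y"
  shows "ennreal (v (f x \<ominus>\<^bsub>A\<^esub> f y)) / d x y \<le> BL_norm X d A v f"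
  unfolding BL_norm_def dil_def using assms
  by (intro max.coboundedI2 SUP_upper2[where i = "(x, y)"]) auto

text \<open>
  The ultrametric inequality survives the passage to \<^typ>\<open>ennreal\<close> and division by an
  arbitrary distance, including the values \<open>0\<close> and \<open>\<infinity>\<close>.
\<close>

lemma ennreal_max_divide_mono:
  fixes c :: ennreal and r s t :: real
  assumes "r \<le> max s t"
  shows "ennreal r / c \<le> max (ennreal s / c) (ennreal t / c)"
proof -
  consider "r \<le> s" | "r \<le> t"
    using assms by linarith
  then show ?thesis
    by cases (auto intro: max.coboundedI1 max.coboundedI2 divide_right_mono_ennreal ennreal_leI)
qed

section \<open>Norm estimates for the algebra operations\<close>

context nonarch_valued_ring
begin

lemma val_zero: "v \<zero> = 0"
  by (simp add: val_zero_iff)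

lemma BL_norm_const:
  assumes "a \<in> carrier A"
  shows "BL_norm X d A v (\<lambda>x\<in>X. a) \<le> ennreal (v a)"
  using assms by (intro BL_norm_leI) (auto simp: minus_eq r_neg val_zero divide_ennreal_def)

lemma BL_norm_add:
  assumes f: "f \<in> X \<rightarrow>\<^sub>E carrier A" and g: "g \<in> X \<rightarrow>\<^sub>E carrier A"
  shows "BL_norm X d A v (\<lambda>x\<in>X. f x \<oplus> g x) \<le> max (BL_norm X d A v f) (BL_norm X d A v g)"
proof (rule BL_norm_leI)
  fix x assume x: "x \<in> X"
  then have carr: "f x \<in> carrier A" "g x \<in> carrier A"
    using f g by auto
  then have "ennreal (v (f x \<oplus> g x)) \<le> ennreal (max (v (f x)) (v (g x)))"
    by (intro ennreal_leI val_add)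
  also have "\<dots> = max (ennreal (v (f x))) (ennreal (v (g x)))"
    using carr by (simp add: max_def val_nonneg)
  also have "\<dots> \<le> max (BL_norm X d A v f) (BL_norm X d A v g)"
    using x by (intro max.mono value_le_BL_norm)
  finally show "ennreal (v ((\<lambda>x\<in>X. f x \<oplus> g x) x)) \<le> max (BL_norm X d A v f) (BL_norm X d A v g)"
    using x by simp
next
  fix x y assume xy: "x \<in> X" "y \<in> X" "x \<noteq> y"
  then have carr: "f x \<in> carrier A" "f y \<in> carrier A" "g x \<in> carrier A" "g y \<in> carrier A"
    using f g by auto
  have "(f x \<oplus> g x) \<ominus> (f y \<oplus> g y) = (f x \<ominus> f y) \<oplus> (g x \<ominus> g y)"
    using carr by algebra
  then have "ennreal (v ((f x \<oplus> g x) \<ominus> (f y \<oplus> g y))) / d x y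
      \<le> max (ennreal (v (f x \<ominus> f y)) / d x y) (ennreal (v (g x \<ominus> g y)) / d x y)"
    using carr by (simp add: ennreal_max_divide_mono val_add)
  also have "\<dots> \<le> max (BL_norm X d A v f) (BL_norm X d A v g)"
    using xy by (intro max.mono quotient_le_BL_norm)
  finally show "ennreal (v ((\<lambda>x\<in>X. f x \<oplus> g x) x \<ominus> (\<lambda>x\<in>X. f x \<oplus> g x) y)) / d x y
      \<le> max (BL_norm X d A v f) (BL_norm X d A v g)"
    using xy by simp
qed

text \<open>
  Both terms of the Leibniz splitting, after division by the distance, are a value of one factor
  times a difference quotient of the other, hence at most the product of the norms; so is their
  maximum.
\<close>

lemma BL_norm_mult:
  assumes f: "f \<in> X \<rightarrow>\<^sub>E carrier A" and g: "g \<in> X \<rightarrow>\<^sub>E carrier A"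
  shows "BL_norm X d A v (\<lambda>x\<in>X. f x \<otimes> g x) \<le> BL_norm X d A v f * BL_norm X d A v g"
    (is "_ \<le> ?F * ?G")
proof (rule BL_norm_leI)
  fix x assume x: "x \<in> X"
  then have "f x \<in> carrier A" "g x \<in> carrier A"
    using f g by auto
  then have "ennreal (v (f x \<otimes> g x)) = ennreal (v (f x)) * ennreal (v (g x))"
    by (simp add: val_mult ennreal_mult val_nonneg)
  also have "\<dots> \<le> ?F * ?G"
    using x by (intro mult_mono value_le_BL_norm) auto
  finally show "ennreal (v ((\<lambda>x\<in>X. f x \<otimes> g x) x)) \<le> ?F * ?G"
    using x by simp
next
  fix x y assume xy: "x \<in> X" "y \<in> X" "x \<noteq> y"
  then have carr: "f x \<in> carrier A" "f y \<in> carrier A" "g x \<in> carrier A" "g y \<in> carrier A"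
    using f g by auto
  have split: "f x \<otimes> g x \<ominus> f y \<otimes> g y = f x \<otimes> (g x \<ominus> g y) \<oplus> g y \<otimes> (f x \<ominus> f y)"
    using carr by algebra
  have "ennreal (v (f x \<otimes> g x \<ominus> f y \<otimes> g y)) / d x y
      \<le> max (ennreal (v (f x \<otimes> (g x \<ominus> g y))) / d x y) (ennreal (v (g y \<otimes> (f x \<ominus> f y))) / d x y)"
    using carr unfolding split by (intro ennreal_max_divide_mono val_add) auto
  also have "\<dots> = max (ennreal (v (f x)) * (ennreal (v (g x \<ominus> g y)) / d x y))
      (ennreal (v (g y)) * (ennreal (v (f x \<ominus> f y)) / d x y))"
    using carr by (simp add: val_mult ennreal_mult val_nonneg ennreal_times_divide)
  also have "\<dots> \<le> max (?F * ?G) (?G * ?F)"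
    using xy by (intro max.mono mult_mono value_le_BL_norm quotient_le_BL_norm) auto
  finally show "ennreal (v ((\<lambda>x\<in>X. f x \<otimes> g x) x \<ominus> (\<lambda>x\<in>X. f x \<otimes> g x) y)) / d x y \<le> ?F * ?G"
    using xy by (simp add: mult.commute)
qed

text \<open>
  Equality for scalars, where the product estimate gives only an upper bound, because the
  valuation is multiplicative: each value and each quotient is scaled by exactly \<open>v a\<close>.
\<close>

lemma BL_norm_smult:
  assumes a: "a \<in> carrier A" and f: "f \<in> X \<rightarrow>\<^sub>E carrier A"
  shows "BL_norm X d A v (\<lambda>x\<in>X. a \<otimes> f x) = ennreal (v a) * BL_norm X d A v f"
proof -
  have sup: "sup_norm X v (\<lambda>x\<in>X. a \<otimes> f x) = ennreal (v a) * sup_norm X v f"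
    unfolding sup_norm_def SUP_mult_left_ennreal
  proof (intro SUP_cong refl)
    fix x assume x: "x \<in> X"
    then have "f x \<in> carrier A"
      using f by auto
    with a x show "ennreal (v ((\<lambda>x\<in>X. a \<otimes> f x) x)) = ennreal (v a) * ennreal (v (f x))"
      by (simp add: val_mult val_nonneg ennreal_mult)
  qed
  have quot: "ennreal (v (a \<otimes> f x \<ominus> a \<otimes> f y)) / d x y
      = ennreal (v a) * (ennreal (v (f x \<ominus> f y)) / d x y)" if "x \<in> X" "y \<in> X" for x y
  proof -
    have carr: "f x \<in> carrier A" "f y \<in> carrier A"
      using f that by auto
    have "a \<otimes> f x \<ominus> a \<otimes> f y = a \<otimes> (f x \<ominus> f y)"
      using a carr by algebra
    then show ?thesis
      using a carr by (simp add: val_mult val_nonneg ennreal_mult ennreal_times_divide)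
  qed
  have "dil X d A v (\<lambda>x\<in>X. a \<otimes> f x) = ennreal (v a) * dil X d A v f"
    unfolding dil_def SUP_mult_left_ennreal
    by (intro SUP_cong) (auto simp: quot)
  moreover have "mono (\<lambda>t::ennreal. ennreal (v a) * t)"
    by (intro monoI mult_left_mono) auto
  ultimately show ?thesis
    unfolding BL_norm_def using sup by (simp add: max_of_mono)
qed

lemma BL_norm_eq_0:
  assumes f: "f \<in> X \<rightarrow>\<^sub>E carrier A" and "BL_norm X d A v f = 0"
  shows "f = (\<lambda>x\<in>X. \<zero>)"
proof (rule PiE_ext[OF f])
  fix x assume x: "x \<in> X"
  then have "ennreal (v (f x)) \<le> 0"
    using value_le_BL_norm[of x X v f d A] assms(2) by simp
  moreover have "f x \<in> carrier A"
    using f x by auto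
  ultimately show "f x = (\<lambda>x\<in>X. \<zero>) x"
    using x by (metis antisym ennreal_eq_0_iff le_zero_eq restrict_apply val_nonneg val_zero_iff)
qed auto

section \<open>The subalgebra of bounded Lipschitz maps and its norm\<close>

lemma BL_D:
  assumes "f \<in> BL X d A v"
  shows "f \<in> X \<rightarrow>\<^sub>E carrier A" and "BL_norm X d A v f < \<infinity>"
  using assms by (auto simp: BL_def map_algebra_def)

lemma BL_const:
  assumes "a \<in> carrier A"
  shows "(\<lambda>x\<in>X. a) \<in> BL X d A v"
  using assms le_less_trans[OF BL_norm_const[OF assms] ennreal_less_top]
  by (auto simp: BL_def map_algebra_def)

lemma BL_add_closed:
  assumes f: "f \<in> BL X d A v" and g: "g \<in> BL X d A v"
  shows "f \<oplus>\<^bsub>map_algebra X A\<^esub> g \<in> BL X d A v"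
proof -
  have "max (BL_norm X d A v f) (BL_norm X d A v g) < \<infinity>"
    using BL_D(2)[OF f] BL_D(2)[OF g] by simp
  then have "BL_norm X d A v (\<lambda>x\<in>X. f x \<oplus> g x) < \<infinity>"
    by (rule le_less_trans[OF BL_norm_add[OF BL_D(1)[OF f] BL_D(1)[OF g]]])
  then show ?thesis
    using BL_D(1)[OF f] BL_D(1)[OF g] by (auto simp: BL_def map_algebra_def)
qed

lemma BL_mult_closed:
  assumes f: "f \<in> BL X d A v" and g: "g \<in> BL X d A v"
  shows "f \<otimes>\<^bsub>map_algebra X A\<^esub> g \<in> BL X d A v"
proof -
  have "BL_norm X d A v f * BL_norm X d A v g < \<infinity>"
    using BL_D(2)[OF f] BL_D(2)[OF g] by (simp add: ennreal_mult_less_top)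
  then have "BL_norm X d A v (\<lambda>x\<in>X. f x \<otimes> g x) < \<infinity>"
    by (rule le_less_trans[OF BL_norm_mult[OF BL_D(1)[OF f] BL_D(1)[OF g]]])
  then show ?thesis
    using BL_D(1)[OF f] BL_D(1)[OF g] by (auto simp: BL_def map_algebra_def)
qed

lemma BL_smult_closed:
  assumes a: "a \<in> carrier A" and f: "f \<in> BL X d A v"
  shows "a \<odot>\<^bsub>map_algebra X A\<^esub> f \<in> BL X d A v"
proof -
  have "BL_norm X d A v (\<lambda>x\<in>X. a \<otimes> f x) < \<infinity>"
    using a BL_D[OF f] by (simp add: BL_norm_smult ennreal_mult_less_top)
  then show ?thesis
    using a BL_D(1)[OF f] by (auto simp: BL_def map_algebra_def)
qed

lemma submodule_BL: "submodule (BL X d A v) A (map_algebra X A)"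
proof -
  interpret M: algebra A "map_algebra X A"
    by (rule algebra_map_algebra) (rule cring_axioms)
  show ?thesis
  proof (rule M.submoduleI)
    show "\<zero>\<^bsub>map_algebra X A\<^esub> \<in> BL X d A v"
      using BL_const[OF zero_closed, of X d] by (simp add: map_algebra_def)
    \<comment> \<open>An additive inverse is the multiple by \<open>\<ominus> \<one>\<close>.\<close>
    show "\<ominus>\<^bsub>map_algebra X A\<^esub> f \<in> BL X d A v" if f: "f \<in> BL X d A v" for f
    proof -
      have "f \<in> carrier (map_algebra X A)"
        using f by (simp add: BL_def)
      then have "\<ominus>\<^bsub>map_algebra X A\<^esub> f = (\<ominus> \<one>) \<odot>\<^bsub>map_algebra X A\<^esub> f"
        by (simp add: M.smult_l_minus)
      then show ?thesis
        using BL_smult_closed[OF _ f] by simp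
    qed
  qed (auto simp: BL_add_closed BL_smult_closed, simp add: BL_def)
qed

lemma is_subalgebra_BL: "is_subalgebra (BL X d A v) A (map_algebra X A)"
proof -
  interpret M: algebra A "map_algebra X A"
    by (rule algebra_map_algebra) (rule cring_axioms)
  have "subring (BL X d A v) (map_algebra X A)"
  proof (rule M.subringI)
    show "\<one>\<^bsub>map_algebra X A\<^esub> \<in> BL X d A v"
      using BL_const[OF one_closed, of X d] by (simp add: map_algebra_def)
  qed (auto simp: BL_add_closed BL_mult_closed M.submoduleE(3)[OF submodule_BL],
      simp add: BL_def)
  then show ?thesis
    unfolding is_subalgebra_def using M.algebra_axioms submodule_BL by blast
qed

lemma nonarch_module_norm_BL:
  "nonarch_module_norm A v ((map_algebra X A)\<lparr>carrier := BL X d A v\<rparr>)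
    (\<lambda>f. enn2real (BL_norm X d A v f))"
proof -
  interpret M: algebra A "map_algebra X A"
    by (rule algebra_map_algebra) (rule cring_axioms)
  interpret B: module A "(map_algebra X A)\<lparr>carrier := BL X d A v\<rparr>"
    by (rule submodule.submodule_is_module[OF submodule_BL M.module_axioms])
  show ?thesis
  proof
    fix f assume "f \<in> carrier ((map_algebra X A)\<lparr>carrier := BL X d A v\<rparr>)"
    then have f: "f \<in> BL X d A v"
      by simp
    have "BL_norm X d A v f = 0 \<longleftrightarrow> f = (\<lambda>x\<in>X. \<zero>)"
      using BL_norm_eq_0[OF BL_D(1)[OF f]] BL_norm_const[OF zero_closed, of X d]
      by (auto simp: val_zero)
    then show "enn2real (BL_norm X d A v f) = 0
        \<longleftrightarrow> f = \<zero>\<^bsub>(map_algebra X A)\<lparr>carrier := BL X d A v\<rparr>\<^esub>"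
      using BL_D(2)[OF f] by (auto simp: enn2real_eq_0_iff map_algebra_def)
  next
    fix f g assume "f \<in> carrier ((map_algebra X A)\<lparr>carrier := BL X d A v\<rparr>)"
      "g \<in> carrier ((map_algebra X A)\<lparr>carrier := BL X d A v\<rparr>)"
    then have f: "f \<in> BL X d A v" and g: "g \<in> BL X d A v"
      by simp_all
    have "enn2real (BL_norm X d A v (\<lambda>x\<in>X. f x \<oplus> g x))
        \<le> enn2real (max (BL_norm X d A v f) (BL_norm X d A v g))"
      using BL_D[OF f] BL_D[OF g] by (intro enn2real_mono BL_norm_add) auto
    also have "\<dots> \<le> max (enn2real (BL_norm X d A v f)) (enn2real (BL_norm X d A v g))"
      by (simp add: max_def)
    finally show "enn2real (BL_norm X d A v (f \<oplus>\<^bsub>(map_algebra X A)\<lparr>carrier := BL X d A v\<rparr>\<^esub> g))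
        \<le> max (enn2real (BL_norm X d A v f)) (enn2real (BL_norm X d A v g))"
      by (simp add: map_algebra_def)
  next
    fix a f assume a: "a \<in> carrier A"
      and "f \<in> carrier ((map_algebra X A)\<lparr>carrier := BL X d A v\<rparr>)"
    then have "f \<in> X \<rightarrow>\<^sub>E carrier A"
      by (simp add: BL_D)
    with a show "enn2real (BL_norm X d A v (a \<odot>\<^bsub>(map_algebra X A)\<lparr>carrier := BL X d A v\<rparr>\<^esub> f))
        = v a * enn2real (BL_norm X d A v f)"
      by (simp add: map_algebra_def BL_norm_smult enn2real_mult val_nonneg)
  qed simp
qed

end

theorem theorem4p11:
  fixes X :: "'x set" and d :: "'x \<Rightarrow> 'x \<Rightarrow> ennreal"
    and A :: "('a, 'm) ring_scheme" and v :: "'a \<Rightarrow> real"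
  assumes "nonarch_metric_space X d"
    and "\<And>B. is_ball X d B \<Longrightarrow> \<exists>x\<in>B. \<exists>y\<in>B. x \<noteq> y"
    and "nonarch_valued_ring A v"
  shows "is_subalgebra (BL X d A v) A (map_algebra X A) \<and>
    nonarch_module_norm A v ((map_algebra X A)\<lparr>carrier := BL X d A v\<rparr>)
      (\<lambda>f. enn2real (BL_norm X d A v f)) \<and>
    (\<forall>f\<in>BL X d A v. \<forall>g\<in>BL X d A v.
      BL_norm X d A v (f \<otimes>\<^bsub>map_algebra X A\<^esub> g) \<le> BL_norm X d A v f * BL_norm X d A v g)"
proof -
  interpret nonarch_valued_ring A v by fact
  show ?thesis
    using is_subalgebra_BL nonarch_module_norm_BL BL_norm_mult[OF BL_D(1) BL_D(1)]
    by (auto simp: map_algebra_def)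
qed

end
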